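(* Let $\emptyset\neq\mathfrak{T}\subseteq\mathrm{WO}(N)$ be such that $\mathfrak{T}$ is closed in $\mathrm{TO}(N)$ and $A_K^{t,\Phi}$ is multiplicative on $\mathfrak{T}$, and let $L$ be a left ideal of $A$. Let $\mathfrak{D}$ be a dense subset of $\mathfrak{T}$. Then there exist finitely many ${\preceq}_1,\dots,{\preceq}_s\in\mathfrak{D}$ and subsets $G_1,\dots,G_s$ of $L$, with $G_j$ a Gröbner basis of $L$ with respect to ${\preceq}_j$ for each $j$, such that $\bigcup_{1\le j\le s}G_j$ is a $\mathfrak{T}$-universal Gröbner basis of $L$.
   Context: An algebra of countable type $A_K^{t,\Phi}=(A,K,t,\Phi)$ consists of an associative unital, not necessarily commutative algebra $A$ over a field $K$, a nonnegative integer $t$, and a $K$-module isomorphism $\Phi:A\to K[X]=K[X_1,\dots,X_t]$ (commutative polynomial ring; $\Phi$ need not be multiplicative). $M=\{X^\nu\mid\nu\in\mathbb{N}_0^t\}$ is the set of monomials and $N=\Phi^{-1}(M)$ is the canonical $K$-basis of $A$. For a set $S$, $\mathrm{TO}(S)$ is the set of all total orderings on $S$ (antisymmetric, transitive, total binary relations), with the coarsest topology for which all sets $\mathfrak{U}_{(a,b)}=\{{\preceq}\in\mathrm{TO}(S)\mid a\preceq b\}$ are open; subsets carry the relative topology. $\mathrm{WO}(S)\subseteq\mathrm{TO}(S)$ is the set of total orderings that are well-orderings. Let $\phi:\mathrm{TO}(N)\to\mathrm{TO}(M)$ be the bijection given by $\Phi(n)\,\phi({\preceq})\,\Phi(n')\Leftrightarrow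 n\preceq n'$. For ${\preceq}\in\mathrm{TO}(N)$ and $a\in A\setminus\{0\}$, $\mathrm{LM}_\preceq(a)\in M$ is the $\phi({\preceq})$-maximal monomial occurring in $\Phi(a)$ with nonzero coefficient. For $H\subseteq A$, $\mathrm{LM}_\preceq(H)$ is the ideal of $K[X]$ generated by $\{\mathrm{LM}_\preceq(h)\mid h\in H\setminus\{0\}\}$. For $\mathfrak{T}\subseteq\mathrm{TO}(N)$, $A_K^{t,\Phi}$ is multiplicative on $\mathfrak{T}$ if $A$ is a domain and $\mathrm{LM}_\preceq(ab)=\mathrm{LM}_\preceq(a)\mathrm{LM}_\preceq(b)$ for all $a,b\in A\setminus\{0\}$ and all ${\preceq}\in\mathfrak{T}$. A Gröbner basis of a left ideal $L$ of $A$ with respect to ${\preceq}\in\mathrm{TO}(N)$ is a finite subset $G\subseteq L$ with $L=\sum_{g\in G}Ag$ and $\mathrm{LM}_\preceq(L)=\mathrm{LM}_\preceq(G)$. A $\mathfrak{T}$-universal Gröbner basis of $L$ is a finite subset of $L$ that is a Gröbner basis of $L$ with respect to every ${\preceq}\in\mathfrak{T}$. *)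

theory Defs
  imports
    "HOL-Library.Poly_Mapping"
    "HOL-Algebra.Algebraic_Closure_Type"
    "HOL-Analysis.Function_Topology"
begin

text \<open>
  Polynomials in $X_1, \dots, X_t$ over \<open>'k\<close> live in the type of polynomials in countably many
  variables, a polynomial being the finitely supported map from exponent vectors to coefficients
  and its product being the convolution product of \<open>Poly_Mapping\<close>. The ring $K[X_1,\dots,X_t]$ is
  the carrier \<open>mpolys t\<close>; this way \<open>t\<close> is an ordinary natural number and may be \<open>0\<close>.
\<close>

type_synonym 'k mpoly = "(nat \<Rightarrow>\<^sub>0 nat) \<Rightarrow>\<^sub>0 'k"

definition exponents :: "nat \<Rightarrow> (nat \<Rightarrow>\<^sub>0 nat) set" where
  "exponents t = {\<nu>. Poly_Mapping.keys \<nu> \<subseteq> {1..t}}"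

definition mpolys :: "nat \<Rightarrow> 'k::field mpoly set" where
  "mpolys t = {p. Poly_Mapping.keys p \<subseteq> exponents t}"

definition mpoly_ring :: "nat \<Rightarrow> 'k::field mpoly ring" where
  "mpoly_ring t = ring_of_type_algebra\<lparr>carrier := mpolys t\<rparr>"

definition mpoly_scale :: "'k::field \<Rightarrow> 'k mpoly \<Rightarrow> 'k mpoly" where
  "mpoly_scale c p = Poly_Mapping.map ((*) c) p"

definition monomial :: "(nat \<Rightarrow>\<^sub>0 nat) \<Rightarrow> 'k::field mpoly" where
  "monomial \<nu> = Poly_Mapping.single \<nu> 1"

definition monomials :: "nat \<Rightarrow> 'k::field mpoly set" where
  "monomials t = monomial ` exponents t"

definition monomials_of :: "'k::field mpoly \<Rightarrow> 'k mpoly set" where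
  "monomials_of p = monomial ` Poly_Mapping.keys p"

lemma exponents_zero: "0 \<in> exponents t"
  by (simp add: exponents_def)

lemma exponents_add: "\<mu> \<in> exponents t \<Longrightarrow> \<nu> \<in> exponents t \<Longrightarrow> \<mu> + \<nu> \<in> exponents t"
  using Poly_Mapping.keys_add[of \<mu> \<nu>] by (auto simp: exponents_def)

lemma mpoly_ring_cring: "cring (mpoly_ring t :: 'k::field mpoly ring)"
proof -
  let ?R = "ring_of_type_algebra :: 'k mpoly ring"
  interpret R: cring ?R by (rule cring_from_type_algebra)
  have minus: "\<ominus>\<^bsub>?R\<^esub> p = - p" for p :: "'k mpoly"
    by (rule R.minus_equality) (auto simp: ring_of_type_algebra_def)
  have "subcring (mpolys t) ?R"
  proof (intro R.subcringI' R.subringI)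
    fix p q :: "'k mpoly" assume pq: "p \<in> mpolys t" "q \<in> mpolys t"
    show "\<ominus>\<^bsub>?R\<^esub> p \<in> mpolys t"
      using pq by (auto simp: minus mpolys_def in_keys_iff)
    show "p \<oplus>\<^bsub>?R\<^esub> q \<in> mpolys t"
      using pq Poly_Mapping.keys_add[of p q] by (auto simp: ring_of_type_algebra_def mpolys_def)
    show "p \<otimes>\<^bsub>?R\<^esub> q \<in> mpolys t"
      using pq keys_mult[of p q] exponents_add
      by (fastforce simp: ring_of_type_algebra_def mpolys_def)
  qed (auto simp: ring_of_type_algebra_def mpolys_def exponents_zero)
  then show ?thesis
    unfolding mpoly_ring_def using R.subcring_iff[of "mpolys t"]
    by (simp add: ring_of_type_algebra_def)
qed


text \<open>
  The class \<open>ring_1\<close> demands \<open>0 \<noteq> 1\<close>. This is no restriction, since an algebra isomorphic to a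
  polynomial ring as a vector space is nonzero.
\<close>

locale countable_type_algebra = vector_space scale
  for scale :: "'k::field \<Rightarrow> 'a::ring_1 \<Rightarrow> 'a" +
  fixes t :: nat and \<Phi> :: "'a \<Rightarrow> 'k mpoly"
  assumes scale_mult_left: "scale c a * b = scale c (a * b)"
    and scale_mult_right: "a * scale c b = scale c (a * b)"
    and linear_Phi: "Vector_Spaces.linear scale mpoly_scale \<Phi>"
    and bij_Phi: "bij_betw \<Phi> UNIV (mpolys t)"

definition canonical_basis :: "nat \<Rightarrow> ('a \<Rightarrow> 'k::field mpoly) \<Rightarrow> 'a set" where
  "canonical_basis t \<Phi> = \<Phi> -` monomials t"


text \<open>An ordering is the set of all pairs \<open>(a, b)\<close> with $a \preceq b$.\<close>

definition total_orders :: "'s set \<Rightarrow> 's rel set" where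
  "total_orders S = {r. linear_order_on S r}"

definition well_orders :: "'s set \<Rightarrow> 's rel set" where
  "well_orders S = {r. well_order_on S r}"

text \<open>
  The whole space is added to the subbasis because \<open>topology_generated_by\<close> takes the union of
  the generators as the underlying space, which would be empty for empty \<open>S\<close>.
\<close>

definition total_orders_topology :: "'s set \<Rightarrow> 's rel topology" where
  "total_orders_topology S =
     topology_generated_by
       (insert (total_orders S) {{r \<in> total_orders S. (a, b) \<in> r} | a b. a \<in> S \<and> b \<in> S})"

definition dense_subset :: "'s topology \<Rightarrow> 's set \<Rightarrow> 's set \<Rightarrow> bool" where
  "dense_subset U T D \<longleftrightarrow>
     D \<subseteq> T \<and> Abstract_Topology.closure_of (subtopology U T) D = T"

definition transport_order :: "('a \<Rightarrow> 'b) \<Rightarrow> 'a rel \<Rightarrow> 'b rel" where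
  "transport_order \<Phi> r = map_prod \<Phi> \<Phi> ` r"


definition LM :: "('a \<Rightarrow> 'k::field mpoly) \<Rightarrow> 'a rel \<Rightarrow> 'a \<Rightarrow> 'k mpoly" where
  "LM \<Phi> r a = (THE m. m \<in> monomials_of (\<Phi> a) \<and>
                  (\<forall>m' \<in> monomials_of (\<Phi> a). (m', m) \<in> transport_order \<Phi> r))"

definition LM_ideal :: "nat \<Rightarrow> ('a::zero \<Rightarrow> 'k::field mpoly) \<Rightarrow> 'a rel \<Rightarrow> 'a set \<Rightarrow> 'k mpoly set" where
  "LM_ideal t \<Phi> r H = Idl\<^bsub>mpoly_ring t\<^esub> (LM \<Phi> r ` (H - {0}))"

definition multiplicative_on :: "('a::ring_1 \<Rightarrow> 'k::field mpoly) \<Rightarrow> 'a rel set \<Rightarrow> bool" where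
  "multiplicative_on \<Phi> T \<longleftrightarrow>
     (\<forall>a b :: 'a. a * b = 0 \<longrightarrow> a = 0 \<or> b = 0) \<and>
     (\<forall>r \<in> T. \<forall>a b. a \<noteq> 0 \<longrightarrow> b \<noteq> 0 \<longrightarrow> LM \<Phi> r (a * b) = LM \<Phi> r a * LM \<Phi> r b)"

definition left_ideal :: "'a::ring_1 set \<Rightarrow> bool" where
  "left_ideal L \<longleftrightarrow> 0 \<in> L \<and> (\<forall>x \<in> L. \<forall>y \<in> L. x + y \<in> L) \<and> (\<forall>a. \<forall>x \<in> L. a * x \<in> L)"

definition left_span :: "'a::ring_1 set \<Rightarrow> 'a set" where
  "left_span G = {\<Sum>g\<in>G. c g * g | c. True}"

definition groebner_basis ::
  "nat \<Rightarrow> ('a::ring_1 \<Rightarrow> 'k::field mpoly) \<Rightarrow> 'a set \<Rightarrow> 'a rel \<Rightarrow> 'a set \<Rightarrow> bool" where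
  "groebner_basis t \<Phi> L r G \<longleftrightarrow>
     finite G \<and> G \<subseteq> L \<and> L = left_span G \<and> LM_ideal t \<Phi> r L = LM_ideal t \<Phi> r G"

definition universal_groebner_basis ::
  "nat \<Rightarrow> ('a::ring_1 \<Rightarrow> 'k::field mpoly) \<Rightarrow> 'a set \<Rightarrow> 'a rel set \<Rightarrow> 'a set \<Rightarrow> bool" where
  "universal_groebner_basis t \<Phi> L T G \<longleftrightarrow>
     finite G \<and> G \<subseteq> L \<and> (\<forall>r \<in> T. groebner_basis t \<Phi> L r G)"

end

theory Submission
  imports Defs
begin

text \<open>
  For a well-ordering in \<open>T\<close>, Dickson's lemma and division yield a finite \<open>G \<subseteq> L\<close> whose leading
  monomials divide every leading monomial of \<open>L\<close>. Only finitely many comparisons fix the leading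
  monomials of the elements of \<open>G\<close>, so they stay the same on an open neighbourhood; for an ordering
  of \<open>T\<close> in this neighbourhood the leading monomials of \<open>L\<close> can only increase, hence, as the
  remaining monomials form a basis modulo \<open>L\<close>, they stay the same as well, and \<open>G\<close> remains a Groebner basis. As \<open>T\<close> is compact,
  finitely many such neighbourhoods cover \<open>T\<close>, and each of them meets the dense subset \<open>D\<close>. A
  finite subset of \<open>L\<close> containing a Groebner basis is again one, so the union of the finitely many
  sets \<open>G\<close> is universal.
\<close>

section \<open>Dickson's lemma\<close>

text \<open>Every sequence has a monotone subsequence; a decreasing one is constant after reaching
  its least value, and that tail is weakly increasing.\<close>

lemma nat_seq_mono_subseq:
  fixes f :: "nat \<Rightarrow> nat"
  obtains g :: "nat \<Rightarrow> nat" where "strict_mono g" "mono (\<lambda>n. f (g n))"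
proof -
  obtain g :: "nat \<Rightarrow> nat" where g: "strict_mono g" "monoseq (\<lambda>n. f (g n))"
    using seq_monosub by blast
  show thesis
  proof (cases "incseq (\<lambda>n. f (g n))")
    case True
    then show thesis using that g(1) by blast
  next
    case False
    then have dec: "decseq (\<lambda>n. f (g n))"
      using g(2) monoseq_iff by blast
    define m where "m = (LEAST k. \<exists>n. f (g n) = k)"
    have "\<exists>n. f (g n) = m"
      unfolding m_def by (rule LeastI_ex) blast
    then obtain N where N: "f (g N) = m" ..
    have "f (g (N + n)) = m" for n
    proof (rule antisym)
      show "f (g (N + n)) \<le> m"
        using dec N by (metis decseqD le_add1)
      show "m \<le> f (g (N + n))"
        unfolding m_def by (rule Least_le) blast
    qed
    then show thesis
      using that[of "\<lambda>n. g (N + n)"] g(1) by (simp add: strict_mono_def mono_def)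
  qed
qed

text \<open>Coordinates are treated one at a time: a further subsequence keeps the earlier
  coordinates monotone.\<close>

lemma mono_subseq_coordinates:
  fixes x :: "nat \<Rightarrow> 'i \<Rightarrow> nat"
  assumes "finite I"
  shows "\<exists>g :: nat \<Rightarrow> nat. strict_mono g \<and> (\<forall>i\<in>I. mono (\<lambda>n. x (g n) i))"
  using assms
proof (induction I)
  case empty
  then show ?case using strict_mono_id by blast
next
  case (insert i I)
  then obtain g :: "nat \<Rightarrow> nat" where g: "strict_mono g" "\<forall>j\<in>I. mono (\<lambda>n. x (g n) j)"
    by blast
  obtain h :: "nat \<Rightarrow> nat" where h: "strict_mono h" "mono (\<lambda>n. x (g (h n)) i)"
    using nat_seq_mono_subseq[of "\<lambda>n. x (g n) i"] by blast
  have "strict_mono (g \<circ> h)"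
    using g(1) h(1) by (simp add: strict_mono_def)
  moreover have "\<forall>j\<in>insert i I. mono (\<lambda>n. x ((g \<circ> h) n) j)"
    using g(2) h strict_mono_mono[OF h(1)] by (auto simp: mono_def)
  ultimately show ?case by blast
qed

text \<open>Divisibility of monomials is comparison on \<open>{1..t}\<close>, since all other
  entries of \<open>\<mu>\<close> vanish. The quotient is the truncated difference, which loses
  nothing under this comparison.\<close>

lemma exponents_add_diff:
  assumes "\<mu> \<in> exponents t" "\<nu> \<in> exponents t"
    and "\<And>i. i \<in> {1..t} \<Longrightarrow> Poly_Mapping.lookup \<mu> i \<le> Poly_Mapping.lookup \<nu> i"
  shows "\<nu> - \<mu> \<in> exponents t \<and> \<nu> = \<mu> + (\<nu> - \<mu>)"
proof -
  have le: "Poly_Mapping.lookup \<mu> i \<le> Poly_Mapping.lookup \<nu> i" for i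
  proof (cases "i \<in> {1..t}")
    case False
    then have "i \<notin> Poly_Mapping.keys \<mu>" using assms(1) by (auto simp: exponents_def)
    then show ?thesis by (simp add: in_keys_iff)
  qed (use assms(3) in blast)
  have "\<nu> = \<mu> + (\<nu> - \<mu>)"
    by (rule poly_mapping_eqI) (simp add: lookup_add lookup_minus le)
  moreover have "Poly_Mapping.keys (\<nu> - \<mu>) \<subseteq> Poly_Mapping.keys \<nu>"
    by (auto simp: in_keys_iff lookup_minus)
  ultimately show ?thesis using assms(2) by (auto simp: exponents_def)
qed

text \<open>\<open>B\<close> collects the elements of \<open>E\<close> minimal under divisibility.
  If it were infinite, an injective sequence in it would have a subsequence monotone in every
  coordinate, hence two distinct comparable minimal elements. Among the divisors of
  \<open>\<nu>\<close> in \<open>E\<close>, one of least total degree is minimal.\<close>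

lemma dickson:
  assumes E: "E \<subseteq> exponents t"
  obtains B where "finite B" "B \<subseteq> E" "\<And>\<nu>. \<nu> \<in> E \<Longrightarrow> \<exists>\<mu>\<in>B. \<exists>\<kappa>\<in>exponents t. \<nu> = \<mu> + \<kappa>"
proof -
  define below where "below \<mu> \<nu> \<longleftrightarrow> (\<forall>i\<in>{1..t}. Poly_Mapping.lookup \<mu> i \<le> Poly_Mapping.lookup \<nu> i)"
    for \<mu> \<nu> :: "nat \<Rightarrow>\<^sub>0 nat"
  define deg where "deg \<mu> = (\<Sum>i\<in>{1..t}. Poly_Mapping.lookup \<mu> i)" for \<mu> :: "nat \<Rightarrow>\<^sub>0 nat"
  have below_eq: "\<mu> = \<nu>" if "below \<mu> \<nu>" "deg \<nu> \<le> deg \<mu>" "\<mu> \<in> exponents t" "\<nu> \<in> exponents t" for \<mu> \<nu>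
  proof (rule poly_mapping_eqI)
    fix i
    show "Poly_Mapping.lookup \<mu> i = Poly_Mapping.lookup \<nu> i"
    proof (cases "i \<in> {1..t}")
      case True
      show ?thesis
      proof (rule ccontr)
        assume "Poly_Mapping.lookup \<mu> i \<noteq> Poly_Mapping.lookup \<nu> i"
        then have "Poly_Mapping.lookup \<mu> i < Poly_Mapping.lookup \<nu> i"
          using that(1) True by (simp add: below_def le_neq_implies_less)
        then have "deg \<mu> < deg \<nu>"
          unfolding deg_def using True that(1)
          by (intro sum_strict_mono_ex1) (auto simp: below_def)
        then show False using that(2) by simp
      qed
    next
      case False
      then have "i \<notin> Poly_Mapping.keys \<mu>" "i \<notin> Poly_Mapping.keys \<nu>"
        using that(3,4) by (auto simp: exponents_def)
      then show ?thesis by (simp add: in_keys_iff)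
    qed
  qed
  define B where "B = {\<mu>\<in>E. \<forall>\<nu>\<in>E. below \<nu> \<mu> \<longrightarrow> \<nu> = \<mu>}"
  have "finite B"
  proof (rule ccontr)
    assume "infinite B"
    then obtain x :: "nat \<Rightarrow> nat \<Rightarrow>\<^sub>0 nat" where x: "inj x" "range x \<subseteq> B"
      using infinite_countable_subset by blast
    obtain g :: "nat \<Rightarrow> nat" where g: "strict_mono g"
      "\<forall>i\<in>{1..t}. mono (\<lambda>n. Poly_Mapping.lookup (x (g n)) i)"
      using mono_subseq_coordinates[of "{1..t}" "\<lambda>n. Poly_Mapping.lookup (x n)"] by auto
    have "below (x (g 0)) (x (g 1))"
      using g(2) by (auto simp: below_def mono_def)
    moreover have "x (g 0) \<in> B" "x (g 1) \<in> B"
      using x(2) by auto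
    ultimately have "x (g 0) = x (g 1)"
      unfolding B_def by blast
    then have "g 0 = g 1"
      using x(1) by (auto dest: injD)
    then show False
      using g(1) by (metis strict_mono_eq zero_neq_one)
  qed
  moreover have "B \<subseteq> E" by (auto simp: B_def)
  moreover have "\<exists>\<mu>\<in>B. \<exists>\<kappa>\<in>exponents t. \<nu> = \<mu> + \<kappa>" if "\<nu> \<in> E" for \<nu>
  proof -
    define F where "F = {\<mu>\<in>E. below \<mu> \<nu>}"
    have "\<nu> \<in> F" using that by (simp add: F_def below_def)
    then obtain \<mu> where \<mu>: "\<mu> \<in> F" "\<And>\<kappa>. \<kappa> \<in> F \<Longrightarrow> deg \<mu> \<le> deg \<kappa>"
      using ex_has_least_nat[of "\<lambda>\<mu>. \<mu> \<in> F" \<nu> deg] by blast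
    have "\<mu> \<in> B"
      unfolding B_def
    proof (intro CollectI conjI ballI impI)
      show "\<mu> \<in> E" using \<mu>(1) by (simp add: F_def)
      fix \<kappa> assume \<kappa>: "\<kappa> \<in> E" "below \<kappa> \<mu>"
      then have "\<kappa> \<in> F"
        using \<mu>(1) by (auto simp: F_def below_def intro: order_trans)
      then show "\<kappa> = \<mu>"
        using below_eq[of \<kappa> \<mu>] \<mu> \<kappa> E by (auto simp: F_def)
    qed
    moreover have "\<nu> - \<mu> \<in> exponents t \<and> \<nu> = \<mu> + (\<nu> - \<mu>)"
      using \<mu>(1) that E by (intro exponents_add_diff) (auto simp: F_def below_def)
    ultimately show ?thesis by blast
  qed
  ultimately show thesis using that by blast
qed

section \<open>The space of total orderings\<close>

lemma topspace_total_orders_topology [simp]: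
  "topspace (total_orders_topology S) = total_orders S"
  by (auto simp: total_orders_topology_def)

lemma openin_total_orders_subbasis:
  assumes "a \<in> S" "b \<in> S"
  shows "openin (total_orders_topology S) {r \<in> total_orders S. (a, b) \<in> r}"
  unfolding total_orders_topology_def using assms by (intro topology_generated_by_Basis) blast

text \<open>
  Identifying a relation with its characteristic function, the orderings form a closed subset of a
  power of the two-point space, on which Tychonoff's theorem applies.
\<close>

lemma compact_space_total_orders:
  fixes S :: "'s set"
  shows "compact_space (total_orders_topology S)"
proof -
  define Y where "Y = product_topology (\<lambda>_. discrete_topology (UNIV :: bool set)) (S \<times> S)"
  define F where "F f = {p \<in> S \<times> S. f p}" for f :: "'s \<times> 's \<Rightarrow> bool"
  define C where "C = {f \<in> topspace Y. F f \<in> total_orders S}"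
  have Y: "compact_space Y"
    unfolding Y_def by (simp add: compact_space_product_topology compact_space_discrete_topology)
  have coord: "openin Y {f \<in> topspace Y. f p = v}" if "p \<in> S \<times> S" for p v
  proof -
    have "continuous_map Y (discrete_topology UNIV) (\<lambda>f. f p)"
      unfolding Y_def using that by (rule continuous_map_product_projection)
    then have "openin Y {f \<in> topspace Y. f p \<in> {v}}"
      by (rule openin_continuous_map_preimage) simp
    then show ?thesis by simp
  qed
  have "closedin Y C"
  proof -
    \<comment> \<open>A failure of an order axiom is visible in at most three coordinates of
      \<open>f\<close>, so it is an open condition; the complement of \<open>C\<close> is the union
      of these open sets.\<close>
    define bad_refl where "bad_refl a = {f \<in> topspace Y. f (a, a) = False}" for a
    define bad_total where "bad_total a b =
      {f \<in> topspace Y. f (a, b) = False} \<inter> {f \<in> topspace Y. f (b, a) = False}" for a b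
    define bad_antisym where "bad_antisym a b =
      {f \<in> topspace Y. f (a, b) = True} \<inter> {f \<in> topspace Y. f (b, a) = True}" for a b
    define bad_trans where "bad_trans a b c =
      {f \<in> topspace Y. f (a, b) = True} \<inter> {f \<in> topspace Y. f (b, c) = True}
        \<inter> {f \<in> topspace Y. f (a, c) = False}" for a b c
    \<comment> \<open>The diagonal is left out of the second union: \<open>bad_antisym a a\<close>
      would reject every reflexive relation.\<close>
    define Bad where "Bad = (\<Union>a\<in>S. bad_refl a)
      \<union> (\<Union>a\<in>S. \<Union>b\<in>S - {a}. bad_total a b \<union> bad_antisym a b)
      \<union> (\<Union>a\<in>S. \<Union>b\<in>S. \<Union>c\<in>S. bad_trans a b c)"
    have "openin Y (bad_refl a)" if "a \<in> S" for a
      unfolding bad_refl_def using that by (intro coord) simp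
    moreover have "openin Y (bad_total a b)" "openin Y (bad_antisym a b)" if "a \<in> S" "b \<in> S" for a b
      unfolding bad_total_def bad_antisym_def using that by (intro openin_Int coord; simp)+
    moreover have "openin Y (bad_trans a b c)" if "a \<in> S" "b \<in> S" "c \<in> S" for a b c
      unfolding bad_trans_def using that by (intro openin_Int coord; simp)
    ultimately have "openin Y Bad"
      unfolding Bad_def by (intro openin_Un openin_Union) (auto intro!: openin_Union openin_Un)
    moreover have "C = topspace Y - Bad"
    proof -
      have "F f \<in> total_orders S \<longleftrightarrow> f \<notin> Bad" if "f \<in> topspace Y" for f
      proof
        assume f: "F f \<in> total_orders S"
        have "refl_on S (F f)" "trans (F f)" "antisym (F f)" "total_on S (F f)"
          using f by (auto simp: total_orders_def order_on_defs)
        then show "f \<notin> Bad"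
          unfolding Bad_def bad_refl_def bad_total_def bad_antisym_def bad_trans_def
            F_def refl_on_def trans_def antisym_def total_on_def by (simp; blast)
      next
        assume f: "f \<notin> Bad"
        have refl: "f (a, a)" if "a \<in> S" for a
          using f that \<open>f \<in> topspace Y\<close> by (auto simp: Bad_def bad_refl_def)
        have total: "f (a, b) \<or> f (b, a)" and antisym: "\<not> (f (a, b) \<and> f (b, a))"
          if "a \<in> S" "b \<in> S" "a \<noteq> b" for a b
          using f that \<open>f \<in> topspace Y\<close>
          unfolding Bad_def bad_total_def bad_antisym_def by fastforce+
        have trans: "f (a, c)" if "a \<in> S" "b \<in> S" "c \<in> S" "f (a, b)" "f (b, c)" for a b c
        proof -
          have "f \<notin> bad_trans a b c" using f that(1-3) by (auto simp: Bad_def)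
          then show ?thesis using that \<open>f \<in> topspace Y\<close> by (auto simp: bad_trans_def)
        qed
        have "refl_on S (F f)" using refl by (auto simp: F_def refl_on_def)
        moreover have "trans (F f)" using trans by (auto simp: F_def intro!: transI)
        moreover have "antisym (F f)" using antisym by (fastforce simp: F_def intro!: antisymI)
        moreover have "total_on S (F f)" using total by (auto simp: F_def total_on_def)
        moreover have "F f \<subseteq> S \<times> S" by (auto simp: F_def)
        ultimately show "F f \<in> total_orders S"
          by (simp add: total_orders_def order_on_defs)
      qed
      then show ?thesis by (auto simp: C_def)
    qed
    ultimately show ?thesis by auto
  qed
  then have "compactin Y C"
    using Y closedin_compact_space by blast
  then have "compact_space (subtopology Y C)"
    by (rule compact_space_subtopology)
  moreover have C_sub: "topspace (subtopology Y C) = C"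
    by (auto simp: C_def)
  \<comment> \<open>Continuity is tested on the subbasis, where the preimage of a comparison is a
    coordinate cylinder intersected with \<open>C\<close>.\<close>
  moreover have "continuous_map (subtopology Y C) (total_orders_topology S) F"
    unfolding total_orders_topology_def
  proof (rule continuous_on_generated_topo)
    fix U assume "U \<in> insert (total_orders S) {{r \<in> total_orders S. (a, b) \<in> r} | a b. a \<in> S \<and> b \<in> S}"
    then consider "U = total_orders S"
      | a b where "U = {r \<in> total_orders S. (a, b) \<in> r}" "a \<in> S" "b \<in> S" by blast
    then show "openin (subtopology Y C) (F -` U \<inter> topspace (subtopology Y C))"
    proof cases
      case 1
      then have "F -` U \<inter> topspace (subtopology Y C) = topspace (subtopology Y C)"
        unfolding C_sub by (auto simp: C_def)
      then show ?thesis by (metis openin_topspace)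
    next
      case (2 a b)
      then have "F -` U \<inter> topspace (subtopology Y C) = {f \<in> topspace Y. f (a, b) = True} \<inter> C"
        unfolding C_sub by (auto simp: C_def F_def)
      then show ?thesis
        using coord[of "(a, b)" True] 2 by (auto simp: openin_subtopology)
    qed
  next
    show "F ` topspace (subtopology Y C)
        \<subseteq> \<Union> (insert (total_orders S) {{r \<in> total_orders S. (a, b) \<in> r} | a b. a \<in> S \<and> b \<in> S})"
      unfolding C_sub by (auto simp: C_def)
  qed
  ultimately have "compactin (total_orders_topology S) (F ` C)"
    by (metis image_compactin compact_space_def)
  moreover have "F ` C = total_orders S"
  proof
    show "total_orders S \<subseteq> F ` C"
    proof
      fix r assume r: "r \<in> total_orders S"
      \<comment> \<open>\<open>restrict\<close> makes the characteristic function extensional, as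
        the points of the product space are.\<close>
      define f where "f = restrict (\<lambda>p. p \<in> r) (S \<times> S)"
      have "F f = r"
        using r by (auto simp: F_def f_def total_orders_def order_on_defs)
      moreover have "f \<in> topspace Y"
        by (simp add: Y_def f_def)
      ultimately show "r \<in> F ` C"
        using r by (auto simp: C_def)
    qed
  qed (auto simp: C_def)
  ultimately show ?thesis
    by (simp add: compact_space_def)
qed

lemma finite_set_has_max:
  assumes "linear_order_on S r" "finite F" "F \<noteq> {}" "F \<subseteq> S"
  shows "\<exists>x\<in>F. \<forall>y\<in>F. (y, x) \<in> r"
  using assms(2-4)
proof (induction F rule: finite_ne_induct)
  case (singleton x)
  then show ?case using assms(1) by (auto simp: order_on_defs refl_on_def)
next
  case (insert x F)
  then obtain m where m: "m \<in> F" "\<forall>y\<in>F. (y, m) \<in> r" by auto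
  have r: "refl_on S r" "trans r" "total_on S r"
    using assms(1) by (auto simp: order_on_defs)
  have "(x, m) \<in> r \<or> (m, x) \<in> r"
    using r insert.prems m(1) unfolding total_on_def refl_on_def by (metis insert_subset subsetD)
  moreover have "(x, x) \<in> r"
    using r(1) insert.prems by (auto simp: refl_on_def)
  ultimately show ?case
    using m r(2) by (metis insert_iff transD)
qed

section \<open>Leading exponents\<close>

text \<open>
  Since \<open>LM\<close> always is a monomial, it suffices to track its exponent vector; the ideal of leading
  monomials then becomes a subset of \<open>exponents t\<close> closed under adding exponents.
\<close>

lemma lookup_mpoly_scale [simp]:
  "Poly_Mapping.lookup (mpoly_scale c p) \<nu> = c * Poly_Mapping.lookup p \<nu>"
  unfolding mpoly_scale_def by (transfer fixing: c) (simp add: when_def)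

lemma monomial_eq_iff [simp]:
  "(monomial \<mu> :: 'k::field mpoly) = monomial \<nu> \<longleftrightarrow> \<mu> = \<nu>"
  unfolding monomial_def by (metis keys_single one_neq_zero singleton_inject)

lemma monomial_add:
  "(monomial (\<mu> + \<nu>) :: 'k::field mpoly) = monomial \<mu> * monomial \<nu>"
  by (simp add: monomial_def mult_single)

lemma keys_monomial [simp]: "Poly_Mapping.keys (monomial \<nu> :: 'k::field mpoly) = {\<nu>}"
  by (simp add: monomial_def)

lemma monomial_in_mpolys [simp]: "(monomial \<nu> :: 'k::field mpoly) \<in> mpolys t \<longleftrightarrow> \<nu> \<in> exponents t"
  by (simp add: mpolys_def)

section \<open>Left ideals and left spans\<close>

lemma left_ideal_diff:
  assumes "left_ideal L" "x \<in> L" "y \<in> L"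
  shows "x - y \<in> L"
proof -
  have "x + (- 1) * y \<in> L" using assms by (metis left_ideal_def)
  then show ?thesis by simp
qed

lemma left_ideal_left_span:
  assumes "finite G"
  shows "left_ideal (left_span G)"
  unfolding left_ideal_def left_span_def
proof (intro conjI ballI allI)
  show "0 \<in> {\<Sum>g\<in>G. c g * g | c. True}"
    by (intro CollectI exI[of _ "\<lambda>_. 0"]) simp
next
  fix x y assume "x \<in> {\<Sum>g\<in>G. c g * g | c. True}" "y \<in> {\<Sum>g\<in>G. c g * g | c. True}"
  then obtain c d where "x = (\<Sum>g\<in>G. c g * g)" "y = (\<Sum>g\<in>G. d g * g)" by blast
  then show "x + y \<in> {\<Sum>g\<in>G. c g * g | c. True}"
    by (intro CollectI exI[of _ "\<lambda>g. c g + d g"]) (simp add: sum.distrib distrib_right)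
next
  fix a x assume "x \<in> {\<Sum>g\<in>G. c g * g | c. True}"
  then obtain c where "x = (\<Sum>g\<in>G. c g * g)" by blast
  then show "a * x \<in> {\<Sum>g\<in>G. c g * g | c. True}"
    by (intro CollectI exI[of _ "\<lambda>g. a * c g"]) (simp add: sum_distrib_left mult.assoc)
qed

lemma left_span_subset:
  assumes "left_ideal L" "G \<subseteq> L"
  shows "left_span G \<subseteq> L"
proof -
  have "(\<Sum>g\<in>F. c g * g) \<in> L" if "F \<subseteq> G" for F c
    using that assms by (induction F rule: infinite_finite_induct) (auto simp: left_ideal_def)
  then show ?thesis by (auto simp: left_span_def)
qed

lemma subset_left_span:
  assumes "finite G"
  shows "G \<subseteq> left_span G"
proof
  fix g assume "g \<in> G"
  then have "(\<Sum>h\<in>G. (if h = g then 1 else 0) * h) = g"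
    using assms by (simp add: if_distrib[of "\<lambda>x. x * _"] cong: if_cong)
  then show "g \<in> left_span G"
    unfolding left_span_def by (intro CollectI exI conjI TrueI) (rule sym)
qed

section \<open>Coordinates with respect to the canonical basis\<close>

context countable_type_algebra
begin

text \<open>Exponent vectors index \<open>N\<close> in this way. Outside \<open>exponents t\<close>
  the value is arbitrary, hence the recurring side condition on \<open>\<nu>\<close>.\<close>

definition basis_vec :: "(nat \<Rightarrow>\<^sub>0 nat) \<Rightarrow> 'a" where
  "basis_vec \<nu> = inv_into UNIV \<Phi> (monomial \<nu>)"

text \<open>Comparing basis vectors directly in \<open>r\<close> avoids
  \<open>transport_order\<close>. The description is meaningful only for
  \<open>a \<noteq> 0\<close>, which is why \<open>lead_exps\<close> removes
  \<open>0\<close>.\<close>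

definition lead_exp :: "'a rel \<Rightarrow> 'a \<Rightarrow> (nat \<Rightarrow>\<^sub>0 nat)" where
  "lead_exp r a = (THE \<nu>. \<nu> \<in> Poly_Mapping.keys (\<Phi> a) \<and>
     (\<forall>\<mu>\<in>Poly_Mapping.keys (\<Phi> a). (basis_vec \<mu>, basis_vec \<nu>) \<in> r))"

definition lead_exps :: "'a rel \<Rightarrow> 'a set \<Rightarrow> (nat \<Rightarrow>\<^sub>0 nat) set" where
  "lead_exps r H = lead_exp r ` (H - {0})"

abbreviation N :: "'a set" where
  "N \<equiv> canonical_basis t \<Phi>"

lemma Phi_add: "\<Phi> (a + b) = \<Phi> a + \<Phi> b"
  and Phi_scale: "\<Phi> (scale c a) = mpoly_scale c (\<Phi> a)"
  using linear_Phi by (auto simp: Vector_Spaces.linear_iff)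

lemma Phi_zero [simp]: "\<Phi> 0 = 0"
  using Phi_add[of 0 0] by (metis add.right_neutral add_left_cancel)

lemma Phi_diff: "\<Phi> (a - b) = \<Phi> a - \<Phi> b"
  using Phi_add[of "a - b" b] by simp

lemma Phi_sum: "\<Phi> (sum f A) = (\<Sum>x\<in>A. \<Phi> (f x))"
  by (induction A rule: infinite_finite_induct) (simp_all add: Phi_add)

lemma inj_Phi: "inj \<Phi>"
  using bij_Phi by (simp add: bij_betw_def)

lemma keys_Phi_subset: "Poly_Mapping.keys (\<Phi> a) \<subseteq> exponents t"
  using bij_Phi by (auto simp: bij_betw_def mpolys_def)

lemma Phi_eq_zero_iff [simp]: "\<Phi> a = 0 \<longleftrightarrow> a = 0"
  using inj_Phi Phi_zero by (metis inj_eq)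

lemma Phi_basis_vec [simp]:
  assumes "\<nu> \<in> exponents t"
  shows "\<Phi> (basis_vec \<nu>) = monomial \<nu>"
proof -
  have "monomial \<nu> \<in> range \<Phi>"
    using bij_Phi assms by (simp add: bij_betw_def)
  then show ?thesis by (simp add: basis_vec_def f_inv_into_f)
qed

lemma basis_vec_eq_iff:
  assumes "\<mu> \<in> exponents t" "\<nu> \<in> exponents t"
  shows "basis_vec \<mu> = basis_vec \<nu> \<longleftrightarrow> \<mu> = \<nu>"
  using assms Phi_basis_vec monomial_eq_iff by metis

lemma basis_vec_in_N: "\<nu> \<in> exponents t \<Longrightarrow> basis_vec \<nu> \<in> N"
  by (simp add: canonical_basis_def monomials_def)

lemma basis_expansion:
  "a = (\<Sum>\<nu>\<in>Poly_Mapping.keys (\<Phi> a). scale (Poly_Mapping.lookup (\<Phi> a) \<nu>) (basis_vec \<nu>))"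
    (is "a = ?s")
proof -
  have "\<Phi> a = \<Phi> ?s"
  proof (rule poly_mapping_eqI)
    fix \<mu>
    have "Poly_Mapping.lookup (\<Phi> ?s) \<mu> =
        (\<Sum>\<nu>\<in>Poly_Mapping.keys (\<Phi> a). Poly_Mapping.lookup (\<Phi> a) \<nu> * Poly_Mapping.lookup (monomial \<nu>) \<mu>)"
      unfolding Phi_sum lookup_sum
    proof (rule sum.cong)
      fix \<nu> assume "\<nu> \<in> Poly_Mapping.keys (\<Phi> a)"
      then have "\<nu> \<in> exponents t" using keys_Phi_subset by blast
      then show "Poly_Mapping.lookup (\<Phi> (scale (Poly_Mapping.lookup (\<Phi> a) \<nu>) (basis_vec \<nu>))) \<mu> =
          Poly_Mapping.lookup (\<Phi> a) \<nu> * Poly_Mapping.lookup (monomial \<nu>) \<mu>"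
        by (simp add: Phi_scale)
    qed simp
    also have "\<dots> = (\<Sum>\<nu>\<in>Poly_Mapping.keys (\<Phi> a). if \<nu> = \<mu> then Poly_Mapping.lookup (\<Phi> a) \<nu> else 0)"
      by (intro sum.cong) (auto simp: monomial_def lookup_single)
    also have "\<dots> = Poly_Mapping.lookup (\<Phi> a) \<mu>"
      by (simp add: in_keys_iff)
    finally show "Poly_Mapping.lookup (\<Phi> a) \<mu> = Poly_Mapping.lookup (\<Phi> ?s) \<mu>" ..
  qed
  then show ?thesis using inj_Phi by (simp add: inj_eq)
qed

text \<open>Scalars act as left multiplication by \<open>scale c 1\<close>, so a left ideal is a
  K-subspace.\<close>

lemma left_ideal_scale:
  assumes "left_ideal L" "x \<in> L"
  shows "scale c x \<in> L"
proof -
  have "scale c x = scale c 1 * x" by (simp add: scale_mult_left)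
  then show ?thesis using assms by (simp add: left_ideal_def)
qed

lemma lead_exp_eqI:
  assumes "r \<in> total_orders N" "\<nu> \<in> Poly_Mapping.keys (\<Phi> a)"
    and "\<And>\<mu>. \<mu> \<in> Poly_Mapping.keys (\<Phi> a) \<Longrightarrow> (basis_vec \<mu>, basis_vec \<nu>) \<in> r"
  shows "lead_exp r a = \<nu>"
  unfolding lead_exp_def
proof (rule the_equality)
  fix \<mu> assume \<mu>: "\<mu> \<in> Poly_Mapping.keys (\<Phi> a) \<and>
    (\<forall>\<nu>\<in>Poly_Mapping.keys (\<Phi> a). (basis_vec \<nu>, basis_vec \<mu>) \<in> r)"
  have "antisym r" using assms(1) by (auto simp: total_orders_def order_on_defs)
  then have "basis_vec \<mu> = basis_vec \<nu>" using \<mu> assms by (auto dest: antisymD)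
  then show "\<mu> = \<nu>" using \<mu> assms(2) keys_Phi_subset basis_vec_eq_iff by blast
qed (use assms in blast)

text \<open>The finitely many basis vectors occurring in a nonzero \<open>a\<close> have a maximum
  for any total ordering.\<close>

lemma lead_exp:
  assumes "r \<in> total_orders N" "a \<noteq> 0"
  shows lead_exp_in_keys: "lead_exp r a \<in> Poly_Mapping.keys (\<Phi> a)"
    and lead_exp_max: "\<mu> \<in> Poly_Mapping.keys (\<Phi> a) \<Longrightarrow> (basis_vec \<mu>, basis_vec (lead_exp r a)) \<in> r"
proof -
  have "\<exists>x\<in>basis_vec ` Poly_Mapping.keys (\<Phi> a). \<forall>y\<in>basis_vec ` Poly_Mapping.keys (\<Phi> a). (y, x) \<in> r"
    using assms keys_Phi_subset basis_vec_in_N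
    by (intro finite_set_has_max[of N]) (auto simp: total_orders_def)
  then obtain \<nu> where \<nu>: "\<nu> \<in> Poly_Mapping.keys (\<Phi> a)"
    "\<And>\<mu>. \<mu> \<in> Poly_Mapping.keys (\<Phi> a) \<Longrightarrow> (basis_vec \<mu>, basis_vec \<nu>) \<in> r" by blast
  then have "lead_exp r a = \<nu>" using assms(1) lead_exp_eqI by blast
  then show "lead_exp r a \<in> Poly_Mapping.keys (\<Phi> a)"
    and "\<mu> \<in> Poly_Mapping.keys (\<Phi> a) \<Longrightarrow> (basis_vec \<mu>, basis_vec (lead_exp r a)) \<in> r"
    using \<nu> by auto
qed

lemma lead_exp_in_exponents:
  "r \<in> total_orders N \<Longrightarrow> a \<noteq> 0 \<Longrightarrow> lead_exp r a \<in> exponents t"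
  using lead_exp_in_keys keys_Phi_subset by blast

lemma transport_order_monomial:
  assumes "\<mu> \<in> exponents t" "\<nu> \<in> exponents t"
  shows "(monomial \<mu>, monomial \<nu>) \<in> transport_order \<Phi> r \<longleftrightarrow> (basis_vec \<mu>, basis_vec \<nu>) \<in> r"
proof
  assume "(monomial \<mu>, monomial \<nu>) \<in> transport_order \<Phi> r"
  then obtain x y where "(x, y) \<in> r" "\<Phi> x = monomial \<mu>" "\<Phi> y = monomial \<nu>"
    by (auto simp: transport_order_def)
  then show "(basis_vec \<mu>, basis_vec \<nu>) \<in> r"
    using inj_Phi by (metis basis_vec_def inv_f_f)
next
  assume "(basis_vec \<mu>, basis_vec \<nu>) \<in> r"
  then have "map_prod \<Phi> \<Phi> (basis_vec \<mu>, basis_vec \<nu>) \<in> transport_order \<Phi> r"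
    unfolding transport_order_def by (rule imageI)
  then show "(monomial \<mu>, monomial \<nu>) \<in> transport_order \<Phi> r"
    using assms by simp
qed

lemma LM_eq_monomial_lead_exp:
  assumes "r \<in> total_orders N" "a \<noteq> 0"
  shows "LM \<Phi> r a = monomial (lead_exp r a)"
  unfolding LM_def
proof (rule the_equality)
  show "monomial (lead_exp r a) \<in> monomials_of (\<Phi> a) \<and>
      (\<forall>m'\<in>monomials_of (\<Phi> a). (m', monomial (lead_exp r a)) \<in> transport_order \<Phi> r)"
    using lead_exp[OF assms] keys_Phi_subset[of a]
    by (auto simp: monomials_of_def transport_order_monomial subset_iff)
next
  fix m assume m: "m \<in> monomials_of (\<Phi> a) \<and> (\<forall>m'\<in>monomials_of (\<Phi> a). (m', m) \<in> transport_order \<Phi> r)"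
  then obtain \<nu> where \<nu>: "\<nu> \<in> Poly_Mapping.keys (\<Phi> a)" "m = monomial \<nu>"
    by (auto simp: monomials_of_def)
  have "lead_exp r a = \<nu>"
  proof (rule lead_exp_eqI[OF assms(1) \<nu>(1)])
    fix \<mu> assume "\<mu> \<in> Poly_Mapping.keys (\<Phi> a)"
    then show "(basis_vec \<mu>, basis_vec \<nu>) \<in> r"
      using m \<nu> keys_Phi_subset transport_order_monomial by (auto simp: monomials_of_def subset_iff)
  qed
  then show "m = monomial (lead_exp r a)" using \<nu> by simp
qed

text \<open>An element of \<open>L\<close> with leading exponent \<open>\<mu>\<close> is multiplied
  from the left by \<open>basis_vec \<nu>\<close>: the product stays in \<open>L\<close>, and
  multiplicativity adds the leading exponents.\<close>

lemma lead_exps_add: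
  assumes mult: "multiplicative_on \<Phi> T" and r: "r \<in> T" "r \<in> total_orders N"
    and L: "left_ideal L" and \<mu>: "\<mu> \<in> lead_exps r L" and \<nu>: "\<nu> \<in> exponents t"
  shows "\<mu> + \<nu> \<in> lead_exps r L"
proof -
  obtain h where h: "h \<in> L" "h \<noteq> 0" "lead_exp r h = \<mu>"
    using \<mu> by (auto simp: lead_exps_def)
  have b: "basis_vec \<nu> \<noteq> 0"
    using \<nu> by (metis Phi_basis_vec Phi_zero keys_monomial keys_zero insert_not_empty)
  have prod: "basis_vec \<nu> * h \<noteq> 0"
    using mult b h(2) by (auto simp: multiplicative_on_def)
  have "lead_exp r (basis_vec \<nu>) = \<nu>"
    using lead_exp_in_keys[OF r(2) b] \<nu> by simp
  moreover have "LM \<Phi> r (basis_vec \<nu> * h) = LM \<Phi> r (basis_vec \<nu>) * LM \<Phi> r h"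
    using mult r(1) b h(2) by (auto simp: multiplicative_on_def)
  ultimately have "(monomial (lead_exp r (basis_vec \<nu> * h)) :: 'k mpoly) = monomial (\<nu> + \<mu>)"
    using LM_eq_monomial_lead_exp[OF r(2)] b h prod by (simp add: monomial_add)
  then have "lead_exp r (basis_vec \<nu> * h) = \<mu> + \<nu>"
    by (simp add: add.commute)
  moreover have "basis_vec \<nu> * h \<in> L - {0}"
    using prod h(1) L by (simp add: left_ideal_def)
  ultimately show ?thesis unfolding lead_exps_def by (metis imageI)
qed

section \<open>Division\<close>

text \<open>Here \<open>f\<close> is a complete remainder of \<open>a\<close> modulo
  \<open>L\<close>: the condition concerns all of its monomials, not just the leading one.\<close>

definition reducible :: "'a rel \<Rightarrow> 'a set \<Rightarrow> 'a \<Rightarrow> bool" where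
  "reducible r L a \<longleftrightarrow> (\<exists>f. a - f \<in> L \<and> Poly_Mapping.keys (\<Phi> f) \<inter> lead_exps r L = {})"

lemma reducible_add:
  assumes L: "left_ideal L" and "reducible r L a" "reducible r L b"
  shows "reducible r L (a + b)"
proof -
  obtain f g where fg: "a - f \<in> L" "Poly_Mapping.keys (\<Phi> f) \<inter> lead_exps r L = {}"
    "b - g \<in> L" "Poly_Mapping.keys (\<Phi> g) \<inter> lead_exps r L = {}"
    using assms by (auto simp: reducible_def)
  have "(a - f) + (b - g) \<in> L"
    using L fg unfolding left_ideal_def by blast
  then have "(a + b) - (f + g) \<in> L" by (simp add: algebra_simps)
  moreover have "Poly_Mapping.keys (\<Phi> (f + g)) \<inter> lead_exps r L = {}"
    using fg Poly_Mapping.keys_add[of "\<Phi> f" "\<Phi> g"] by (auto simp: Phi_add)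
  ultimately show ?thesis unfolding reducible_def by blast
qed

lemma reducible_scale:
  assumes L: "left_ideal L" and "reducible r L a"
  shows "reducible r L (scale c a)"
proof -
  obtain f where f: "a - f \<in> L" "Poly_Mapping.keys (\<Phi> f) \<inter> lead_exps r L = {}"
    using assms by (auto simp: reducible_def)
  have "scale c a - scale c f \<in> L"
    using left_ideal_scale[OF L f(1), of c] by (simp add: scale_right_diff_distrib)
  moreover have "Poly_Mapping.keys (\<Phi> (scale c f)) \<subseteq> Poly_Mapping.keys (\<Phi> f)"
    by (auto simp: Phi_scale in_keys_iff)
  ultimately show ?thesis using f unfolding reducible_def by blast
qed

lemma reducible_in_ideal: "a \<in> L \<Longrightarrow> reducible r L a"
  unfolding reducible_def by (rule exI[of _ 0]) simp

text \<open>Reducible elements form a K-subspace, and \<open>a\<close> is a linear combination of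
  the basis vectors at its exponents.\<close>

lemma reducible_if_basis:
  assumes L: "left_ideal L"
    and "\<And>\<nu>. \<nu> \<in> Poly_Mapping.keys (\<Phi> a) \<Longrightarrow> reducible r L (basis_vec \<nu>)"
  shows "reducible r L a"
proof -
  have "reducible r L (\<Sum>\<nu>\<in>F. scale (Poly_Mapping.lookup (\<Phi> a) \<nu>) (basis_vec \<nu>))"
    if "F \<subseteq> Poly_Mapping.keys (\<Phi> a)" for F
    using that
  proof (induction F rule: infinite_finite_induct)
    case (insert x F)
    then show ?case using assms reducible_add reducible_scale by simp
  qed (use L in \<open>auto intro!: reducible_in_ideal simp: left_ideal_def\<close>)
  then show ?thesis by (metis basis_expansion order_refl)
qed

text \<open>Well-founded induction along the strict part of \<open>r\<close>. If
  \<open>\<nu>\<close> is not a leading exponent of \<open>L\<close>, the basis vector is its own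
  remainder; otherwise subtracting a suitable element of \<open>L\<close> leaves only smaller
  exponents.\<close>

lemma reducible_basis_vec:
  assumes r: "r \<in> well_orders N" and L: "left_ideal L"
  shows "\<nu> \<in> exponents t \<Longrightarrow> reducible r L (basis_vec \<nu>)"
proof -
  have wf: "wf (inv_image (r - Id) basis_vec)"
    using r by (auto simp: well_orders_def well_order_on_def)
  show "\<nu> \<in> exponents t \<Longrightarrow> reducible r L (basis_vec \<nu>)"
    using wf
  proof (induction \<nu> rule: wf_induct_rule)
    case (less \<nu>)
    have ro: "r \<in> total_orders N"
      using r by (auto simp: well_orders_def total_orders_def well_order_on_def)
    show ?case
    proof (cases "\<nu> \<in> lead_exps r L")
      case False
      have "basis_vec \<nu> - basis_vec \<nu> \<in> L" using L by (simp add: left_ideal_def)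
      moreover have "Poly_Mapping.keys (\<Phi> (basis_vec \<nu>)) \<inter> lead_exps r L = {}"
        using False less.prems by simp
      ultimately show ?thesis unfolding reducible_def by blast
    next
      case True
      then obtain h where h: "h \<in> L" "h \<noteq> 0" "lead_exp r h = \<nu>"
        by (auto simp: lead_exps_def)
      define c where "c = Poly_Mapping.lookup (\<Phi> h) \<nu>"
      have c: "c \<noteq> 0"
        using lead_exp_in_keys[OF ro h(2)] h(3) by (simp add: c_def in_keys_iff)
      \<comment> \<open>Dividing by the leading coefficient makes the monomial at
        \<open>\<nu>\<close> cancel in \<open>d\<close>.\<close>
      define h' where "h' = scale (inverse c) h"
      define d where "d = basis_vec \<nu> - h'"
      have h': "h' \<in> L" using left_ideal_scale[OF L h(1)] by (simp add: h'_def)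
      have lookup_d: "Poly_Mapping.lookup (\<Phi> d) \<mu> =
          Poly_Mapping.lookup (monomial \<nu>) \<mu> - inverse c * Poly_Mapping.lookup (\<Phi> h) \<mu>" for \<mu>
        using less.prems by (simp add: d_def h'_def Phi_diff Phi_scale lookup_minus)
      have "\<nu> \<notin> Poly_Mapping.keys (\<Phi> d)"
        using c by (simp add: in_keys_iff lookup_d c_def monomial_def)
      moreover have "Poly_Mapping.keys (\<Phi> d) \<subseteq> insert \<nu> (Poly_Mapping.keys (\<Phi> h))"
        by (auto simp: in_keys_iff lookup_d monomial_def lookup_single when_def split: if_splits)
      ultimately have keys_d: "\<mu> \<in> Poly_Mapping.keys (\<Phi> h)" "\<mu> \<noteq> \<nu>"
        if "\<mu> \<in> Poly_Mapping.keys (\<Phi> d)" for \<mu>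
        using that by auto
      have "reducible r L d"
      proof (rule reducible_if_basis[OF L])
        fix \<mu> assume \<mu>: "\<mu> \<in> Poly_Mapping.keys (\<Phi> d)"
        then have "\<mu> \<in> exponents t" using keys_Phi_subset by blast
        moreover have "(basis_vec \<mu>, basis_vec \<nu>) \<in> r - Id"
          using lead_exp_max[OF ro h(2)] keys_d[OF \<mu>] h(3) basis_vec_eq_iff less.prems calculation by auto
        ultimately show "reducible r L (basis_vec \<mu>)"
          using less.IH by simp
      qed
      then have "reducible r L (d + h')"
        using reducible_add L reducible_in_ideal h' by blast
      then show ?thesis by (simp add: d_def)
    qed
  qed
qed

lemma reducible:
  assumes "r \<in> well_orders N" "left_ideal L"
  shows "reducible r L a"
  using reducible_if_basis reducible_basis_vec assms keys_Phi_subset by blast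

section \<open>Groebner bases\<close>

lemma well_orders_subset_total_orders: "well_orders S \<subseteq> total_orders S"
  by (auto simp: well_orders_def total_orders_def well_order_on_def)

text \<open>
  For either ordering the monomials outside the leading exponents of \<open>L\<close> form a basis of the
  quotient by \<open>L\<close>, so neither set of leading exponents can properly contain the other.
\<close>

lemma lead_exps_mono_eq:
  assumes r: "r \<in> total_orders N" and r': "r' \<in> well_orders N"
    and L: "left_ideal L" and sub: "lead_exps r L \<subseteq> lead_exps r' L"
  shows "lead_exps r' L = lead_exps r L"
proof (rule ccontr)
  assume "lead_exps r' L \<noteq> lead_exps r L"
  then obtain \<nu> where \<nu>: "\<nu> \<in> lead_exps r' L" "\<nu> \<notin> lead_exps r L"
    using sub by blast
  have \<nu>e: "\<nu> \<in> exponents t"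
    using \<nu>(1) r' well_orders_subset_total_orders lead_exp_in_exponents
    by (auto simp: lead_exps_def)
  \<comment> \<open>Reducing \<open>basis_vec \<nu>\<close> for \<open>r'\<close> gives an
    \<open>h\<close> in \<open>L\<close> with coefficient 1 at \<open>\<nu>\<close> and all other
    exponents outside \<open>lead_exps r' L\<close>. Thus no exponent of \<open>h\<close> lies in
    \<open>lead_exps r L\<close>, although its leading exponent for \<open>r\<close> must.\<close>
  obtain f where f: "basis_vec \<nu> - f \<in> L" "Poly_Mapping.keys (\<Phi> f) \<inter> lead_exps r' L = {}"
    using reducible[OF r' L] unfolding reducible_def by blast
  define h where "h = basis_vec \<nu> - f"
  have "\<nu> \<notin> Poly_Mapping.keys (\<Phi> f)" using f(2) \<nu>(1) by blast
  then have "Poly_Mapping.lookup (\<Phi> h) \<nu> = 1"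
    using \<nu>e by (simp add: h_def Phi_diff lookup_minus in_keys_iff monomial_def)
  then have "h \<noteq> 0" by auto
  have "Poly_Mapping.keys (\<Phi> h) \<subseteq> insert \<nu> (Poly_Mapping.keys (\<Phi> f))"
    using \<nu>e by (auto simp: h_def Phi_diff lookup_minus in_keys_iff monomial_def lookup_single when_def
        split: if_splits)
  then have "lead_exp r h \<in> insert \<nu> (Poly_Mapping.keys (\<Phi> f))"
    using lead_exp_in_keys[OF r \<open>h \<noteq> 0\<close>] by blast
  then have "lead_exp r h \<notin> lead_exps r L"
    using f(2) \<nu>(2) sub by blast
  then show False
    using \<open>h \<noteq> 0\<close> f(1) by (auto simp: lead_exps_def h_def)
qed

text \<open>The remainder of \<open>h\<close> modulo \<open>L'\<close> lies in \<open>L\<close>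
  again. If nonzero, its leading exponent would be one of \<open>L'\<close>, which a remainder
  excludes; so \<open>h\<close> is in \<open>L'\<close>.\<close>

lemma lead_exps_subset_imp_ideal_subset:
  assumes r: "r \<in> well_orders N" and L': "left_ideal L'" and L: "left_ideal L"
    and "L' \<subseteq> L" and sub: "lead_exps r L \<subseteq> lead_exps r L'"
  shows "L \<subseteq> L'"
proof
  fix h assume h: "h \<in> L"
  obtain f where f: "h - f \<in> L'" "Poly_Mapping.keys (\<Phi> f) \<inter> lead_exps r L' = {}"
    using reducible[OF r L'] unfolding reducible_def by blast
  have "h - (h - f) \<in> L"
    using left_ideal_diff[OF L h] f(1) \<open>L' \<subseteq> L\<close> by blast
  then have "f \<in> L" by simp
  have "f = 0"
  proof (rule ccontr)
    assume "f \<noteq> 0"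
    then have "lead_exp r f \<in> lead_exps r L'"
      using \<open>f \<in> L\<close> sub by (auto simp: lead_exps_def)
    moreover have "lead_exp r f \<in> Poly_Mapping.keys (\<Phi> f)"
      using r well_orders_subset_total_orders lead_exp_in_keys \<open>f \<noteq> 0\<close> by blast
    ultimately show False using f(2) by blast
  qed
  then show "h \<in> L'" using f(1) by simp
qed

text \<open>Divisibility form of the inclusion of \<open>LM_ideal t \<Phi> r L\<close> in
  \<open>LM_ideal t \<Phi> r G\<close>. It sees \<open>r\<close> only through leading exponents, so
  it can be carried from one ordering to another.\<close>

definition leading_generators :: "'a rel \<Rightarrow> 'a set \<Rightarrow> 'a set \<Rightarrow> bool" where
  "leading_generators r L G \<longleftrightarrow>
     (\<forall>\<nu>\<in>lead_exps r L. \<exists>\<mu>\<in>lead_exps r G. \<exists>\<kappa>\<in>exponents t. \<nu> = \<mu> + \<kappa>)"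

lemma leading_generators_mono:
  "leading_generators r L G \<Longrightarrow> G \<subseteq> G' \<Longrightarrow> leading_generators r L G'"
  unfolding leading_generators_def lead_exps_def by blast

text \<open>The leading exponents of \<open>I\<close> are closed under adding exponents, so they
  absorb all multiples of those of \<open>G\<close>. It is applied with
  \<open>I = left_span G\<close>.\<close>

lemma lead_exps_subset_if_generators:
  assumes "multiplicative_on \<Phi> T" "r \<in> T" "r \<in> total_orders N" "left_ideal I"
    and gen: "leading_generators r L G" and sub: "lead_exps r G \<subseteq> lead_exps r I"
  shows "lead_exps r L \<subseteq> lead_exps r I"
proof
  fix \<nu> assume "\<nu> \<in> lead_exps r L"
  then obtain \<mu> \<kappa> where "\<mu> \<in> lead_exps r G" "\<kappa> \<in> exponents t" "\<nu> = \<mu> + \<kappa>"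
    using gen unfolding leading_generators_def by metis
  then show "\<nu> \<in> lead_exps r I"
    using lead_exps_add[OF assms(1-4)] sub by auto
qed

text \<open>Dickson's lemma yields finitely many generating exponents, and each is realised by a
  nonzero element of \<open>L\<close>.\<close>

lemma ex_leading_generators:
  assumes "r \<in> total_orders N"
  shows "\<exists>G. finite G \<and> G \<subseteq> L \<and> leading_generators r L G"
proof -
  have "lead_exps r L \<subseteq> exponents t"
    using lead_exp_in_exponents[OF assms] by (auto simp: lead_exps_def)
  then obtain B where B: "finite B" "B \<subseteq> lead_exps r L"
    "\<And>\<nu>. \<nu> \<in> lead_exps r L \<Longrightarrow> \<exists>\<mu>\<in>B. \<exists>\<kappa>\<in>exponents t. \<nu> = \<mu> + \<kappa>"
    using dickson by metis
  obtain G where G: "G \<subseteq> L - {0}" "finite G" "B = lead_exp r ` G"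
    using finite_subset_image[OF B(1)] B(2) unfolding lead_exps_def by metis
  have "G - {0} = G" using G(1) by blast
  then have "lead_exps r G = B" using G(3) by (simp add: lead_exps_def)
  then have "leading_generators r L G" using B(3) by (simp add: leading_generators_def)
  then show ?thesis using G by blast
qed

text \<open>Both conditions come from \<open>gen\<close>. The leading exponents of \<open>L\<close>
  all occur in \<open>left_span G\<close>, so division forces the two ideals to coincide; and each
  \<open>LM\<close> from \<open>L\<close> is a multiple of one from \<open>G\<close>, so the leading
  ideals agree.\<close>

lemma groebner_basisI:
  assumes mult: "multiplicative_on \<Phi> T" and r: "r \<in> T" "r \<in> well_orders N"
    and L: "left_ideal L" and G: "finite G" "G \<subseteq> L" and gen: "leading_generators r L G"
  shows "groebner_basis t \<Phi> L r G"
proof -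
  have ro: "r \<in> total_orders N" using r well_orders_subset_total_orders by blast
  have span: "left_ideal (left_span G)" using G(1) by (rule left_ideal_left_span)
  have "lead_exps r G \<subseteq> lead_exps r (left_span G)"
    using subset_left_span[OF G(1)] by (auto simp: lead_exps_def)
  then have "lead_exps r L \<subseteq> lead_exps r (left_span G)"
    by (rule lead_exps_subset_if_generators[OF mult r(1) ro span gen])
  then have "L \<subseteq> left_span G"
    using lead_exps_subset_imp_ideal_subset[OF r(2) span L] left_span_subset[OF L G(2)] by blast
  then have "L = left_span G"
    using left_span_subset[OF L G(2)] by blast
  moreover have "LM_ideal t \<Phi> r L = LM_ideal t \<Phi> r G"
  proof -
    let ?R = "mpoly_ring t :: 'k mpoly ring"
    interpret R: cring ?R by (rule mpoly_ring_cring)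
    have carrier: "carrier ?R = mpolys t" and times: "\<And>p q. p \<otimes>\<^bsub>?R\<^esub> q = p * q"
      by (simp_all add: mpoly_ring_def ring_of_type_algebra_def)
    have LM_carrier: "LM \<Phi> r ` (H - {0}) \<subseteq> carrier ?R" for H
      by (rule image_subsetI)
        (simp add: carrier LM_eq_monomial_lead_exp[OF ro] lead_exp_in_exponents[OF ro])
    have idealG: "ideal (LM_ideal t \<Phi> r G) ?R"
      unfolding LM_ideal_def by (rule R.genideal_ideal[OF LM_carrier])
    have "LM \<Phi> r h \<in> LM_ideal t \<Phi> r G" if h: "h \<in> L - {0}" for h
    proof -
      obtain g \<kappa> where g: "g \<in> G - {0}" "\<kappa> \<in> exponents t" "lead_exp r h = lead_exp r g + \<kappa>"
        using gen h unfolding leading_generators_def lead_exps_def by blast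
      have "LM \<Phi> r h = LM \<Phi> r g \<otimes>\<^bsub>?R\<^esub> monomial \<kappa>"
        using g h LM_eq_monomial_lead_exp[OF ro] by (simp add: times monomial_add)
      moreover have "LM \<Phi> r g \<in> LM_ideal t \<Phi> r G"
        using g(1) R.genideal_self[OF LM_carrier] unfolding LM_ideal_def by blast
      moreover have "monomial \<kappa> \<in> carrier ?R" using g(2) by (simp add: carrier)
      ultimately show ?thesis
        using ideal.I_r_closed[OF idealG] by simp
    qed
    then have "LM_ideal t \<Phi> r L \<subseteq> LM_ideal t \<Phi> r G"
      unfolding LM_ideal_def[of t \<Phi> r L] by (intro R.genideal_minimal[OF idealG]) blast
    moreover have "LM_ideal t \<Phi> r G \<subseteq> LM_ideal t \<Phi> r L"
    proof -
      have "LM \<Phi> r ` (G - {0}) \<subseteq> LM_ideal t \<Phi> r L"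
        using G(2) R.genideal_self[OF LM_carrier[of L]] unfolding LM_ideal_def by blast
      then show ?thesis
        unfolding LM_ideal_def[of t \<Phi> r G]
        using R.genideal_minimal R.genideal_ideal[OF LM_carrier[of L]] by (simp add: LM_ideal_def)
    qed
    ultimately show ?thesis by blast
  qed
  ultimately show ?thesis using G by (simp add: groebner_basis_def)
qed

section \<open>Stability of leading generators under nearby orderings\<close>

definition agreement :: "'a rel \<Rightarrow> 'a set \<Rightarrow> 'a rel set" where
  "agreement r G = {r' \<in> total_orders N. \<forall>g\<in>G - {0}. lead_exp r' g = lead_exp r g}"

lemma openin_agreement:
  assumes r: "r \<in> total_orders N" and "finite G"
  shows "openin (total_orders_topology N) (agreement r G)"
  using assms(2)
proof (induction G)
  case empty
  show ?case
    using openin_topspace[of "total_orders_topology N"] by (simp add: agreement_def)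
next
  case (insert g G)
  show ?case
  proof (cases "g = 0")
    case True
    then have "agreement r (insert g G) = agreement r G" by (auto simp: agreement_def)
    then show ?thesis using insert by simp
  next
    case False
    let ?K = "Poly_Mapping.keys (\<Phi> g)"
    let ?U = "\<lambda>\<mu>. {r' \<in> total_orders N. (basis_vec \<mu>, basis_vec (lead_exp r g)) \<in> r'}"
    \<comment> \<open>The leading exponent of \<open>g\<close> is fixed by comparing it with the
      finitely many exponents of \<open>g\<close>; each comparison is a subbasic open
      condition.\<close>
    have *: "lead_exp r' g = lead_exp r g \<longleftrightarrow> (\<forall>\<mu>\<in>?K. r' \<in> ?U \<mu>)" if "r' \<in> total_orders N" for r'
      using lead_exp_max[OF that False] lead_exp_eqI[OF that lead_exp_in_keys[OF r False]] that by auto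
    have "agreement r (insert g G) = (\<Inter>\<mu>\<in>?K. ?U \<mu>) \<inter> agreement r G"
      using False * by (auto simp: agreement_def)
    \<comment> \<open>\<open>openin_INT2\<close> requires a nonempty index set, which
      \<open>g \<noteq> 0\<close> provides.\<close>
    moreover have "openin (total_orders_topology N) (\<Inter>\<mu>\<in>?K. ?U \<mu>)"
    proof (rule openin_INT2)
      show "openin (total_orders_topology N) (?U \<mu>)" if "\<mu> \<in> ?K" for \<mu>
        using that keys_Phi_subset lead_exp_in_exponents[OF r False]
        by (intro openin_total_orders_subbasis basis_vec_in_N) auto
    qed (use False in auto)
    ultimately show ?thesis using insert by auto
  qed
qed

text \<open>Both orderings give \<open>G\<close> the same leading exponents. Multiples of these
  exhaust \<open>lead_exps r L\<close> and lie in \<open>lead_exps r' L\<close>, which is closed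
  under adding exponents; \<open>lead_exps_mono_eq\<close> turns the inclusion into
  equality.\<close>

lemma leading_generators_agreement:
  assumes mult: "multiplicative_on \<Phi> T" and r: "r \<in> total_orders N"
    and r': "r' \<in> T" "r' \<in> well_orders N" "r' \<in> agreement r G"
    and L: "left_ideal L" and G: "G \<subseteq> L" and gen: "leading_generators r L G"
  shows "leading_generators r' L G"
proof -
  have ro': "r' \<in> total_orders N" using r' well_orders_subset_total_orders by blast
  have eq: "lead_exps r' G = lead_exps r G"
    using r'(3) unfolding lead_exps_def agreement_def by (auto intro!: image_cong)
  have "lead_exps r' G \<subseteq> lead_exps r' L" using G by (auto simp: lead_exps_def)
  moreover have gen': "\<exists>\<mu>\<in>lead_exps r' G. \<exists>\<kappa>\<in>exponents t. \<nu> = \<mu> + \<kappa>" if "\<nu> \<in> lead_exps r L" for \<nu>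
    using gen that eq by (simp add: leading_generators_def)
  ultimately have "lead_exps r L \<subseteq> lead_exps r' L"
    using lead_exps_add[OF mult r'(1) ro' L] by (metis subsetI subsetD)
  then have "lead_exps r' L = lead_exps r L"
    by (rule lead_exps_mono_eq[OF r r'(2) L])
  then show ?thesis using gen eq by (simp add: leading_generators_def)
qed

end

section \<open>From a finite subcover to a universal Groebner basis\<close>

theorem lemma10p7:
  fixes scale :: "'k::field \<Rightarrow> 'a::ring_1 \<Rightarrow> 'a"
    and t :: nat
    and \<Phi> :: "'a \<Rightarrow> 'k mpoly"
    and T D :: "'a rel set"
    and L :: "'a set"
  assumes "countable_type_algebra scale t \<Phi>"
    and "T \<noteq> {}"
    and "T \<subseteq> well_orders (canonical_basis t \<Phi>)"
    and "closedin (total_orders_topology (canonical_basis t \<Phi>)) T"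
    and "multiplicative_on \<Phi> T"
    and "left_ideal L"
    and "dense_subset (total_orders_topology (canonical_basis t \<Phi>)) T D"
  shows "\<exists>(s::nat) (ord :: nat \<Rightarrow> 'a rel) (G :: nat \<Rightarrow> 'a set).
           1 \<le> s \<and>
           (\<forall>j \<in> {1..s}. ord j \<in> D \<and> G j \<subseteq> L \<and> groebner_basis t \<Phi> L (ord j) (G j)) \<and>
           universal_groebner_basis t \<Phi> L T (\<Union>j \<in> {1..s}. G j)"
proof -
  interpret countable_type_algebra scale t \<Phi> by fact
  let ?TO = "total_orders_topology N"
  have WO: "r \<in> well_orders N" and TO: "r \<in> total_orders N" if "r \<in> T" for r
    using that assms(3) well_orders_subset_total_orders by blast+
  have "\<exists>G. finite G \<and> G \<subseteq> L \<and> leading_generators r L G" if "r \<in> T" for r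
    using ex_leading_generators TO that by blast
  then obtain H where H: "\<And>r. r \<in> T \<Longrightarrow> finite (H r) \<and> H r \<subseteq> L \<and> leading_generators r L (H r)"
    by metis
  define U where "U r = agreement r (H r)" for r
  have openU: "openin ?TO (U r)" and inU: "r \<in> U r" if "r \<in> T" for r
    using that openin_agreement TO H by (auto simp: U_def agreement_def)
  have gen: "leading_generators r' L (H r)" if "r \<in> T" "r' \<in> T" "r' \<in> U r" for r r'
    using leading_generators_agreement[OF assms(5) TO _ WO _ assms(6)] H that unfolding U_def by blast
  have "compactin ?TO T"
    using closedin_compact_space compact_space_total_orders assms(4) by blast
  moreover have "T \<subseteq> \<Union> (U ` T)" using inU by blast
  ultimately obtain \<F> where "finite \<F>" "\<F> \<subseteq> U ` T" "T \<subseteq> \<Union>\<F>"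
    using compactinD[of ?TO T "U ` T"] openU by blast
  then obtain R where R: "R \<subseteq> T" "finite R" "T \<subseteq> (\<Union>r\<in>R. U r)"
    using finite_subset_image by metis
  \<comment> \<open>Each \<open>r\<close> in \<open>T\<close> lies in the closure of
    \<open>D\<close> within \<open>T\<close>, so its relatively open neighbourhood
    \<open>U r \<inter> T\<close> meets \<open>D\<close>.\<close>
  have "\<exists>d\<in>D. d \<in> U r" if "r \<in> T" for r
  proof -
    have "r \<in> subtopology ?TO T closure_of D"
      using assms(7) that by (simp add: dense_subset_def)
    moreover have "openin (subtopology ?TO T) (U r \<inter> T)" "r \<in> U r \<inter> T"
      using openU inU that by (auto simp: openin_subtopology)
    ultimately show ?thesis unfolding in_closure_of by blast
  qed
  then obtain d where d: "\<And>r. r \<in> T \<Longrightarrow> d r \<in> D \<and> d r \<in> U r" by metis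
  have DT: "D \<subseteq> T" using assms(7) by (simp add: dense_subset_def)
  define s where "s = card R"
  obtain e where e: "bij_betw e {1..s} R"
    using R(2) finite_same_card_bij[of "{1..s}" R] by (auto simp: s_def)
  \<comment> \<open>A cover of the nonempty \<open>T\<close> has a member; this gives
    \<open>1 \<le> s\<close>.\<close>
  have "R \<noteq> {}" using R(3) assms(2) by auto
  then have "1 \<le> s" using R(2) by (simp add: s_def Suc_le_eq card_gt_0_iff)
  have eT: "e j \<in> T" if "j \<in> {1..s}" for j
    using e that R(1) by (auto simp: bij_betw_def)
  have union: "(\<Union>j\<in>{1..s}. H (e j)) = (\<Union>r\<in>R. H r)"
    using e by (auto simp: bij_betw_def)
  \<comment> \<open>\<open>H (e j)\<close> was chosen for \<open>e j\<close>, but the ordering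
    claimed is \<open>d (e j)\<close>, an element of \<open>D\<close>. It lies in
    \<open>U (e j)\<close>, so \<open>gen\<close> transfers the leading generators.\<close>
  have "groebner_basis t \<Phi> L (d (e j)) (H (e j))" if "j \<in> {1..s}" for j
  proof (rule groebner_basisI[OF assms(5) _ WO assms(6)])
    show dT: "d (e j) \<in> T" "d (e j) \<in> T" using d[OF eT[OF that]] DT by auto
    show "leading_generators (d (e j)) L (H (e j))"
      using gen[OF eT[OF that] dT(1)] d[OF eT[OF that]] by blast
  qed (use H[OF eT[OF that]] in auto)
  \<comment> \<open>Every \<open>r\<close> in \<open>T\<close> lies in some \<open>U p\<close>, so
    \<open>H p\<close> already has enough leading monomials for \<open>r\<close>, and the union only
    enlarges it.\<close>
  moreover have "groebner_basis t \<Phi> L r (\<Union>r\<in>R. H r)" if rT: "r \<in> T" for r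
  proof (rule groebner_basisI[OF assms(5) rT WO[OF rT] assms(6)])
    obtain p where p: "p \<in> R" "r \<in> U p" using R(3) rT by auto
    then show "leading_generators r L (\<Union>r\<in>R. H r)"
      using leading_generators_mono[of r L "H p"] gen[of p r] rT R(1) by blast
  qed (use R H in auto)
  moreover have "universal_groebner_basis t \<Phi> L T (\<Union>j\<in>{1..s}. H (e j))"
    unfolding universal_groebner_basis_def union using calculation(2) H R by blast
  moreover have "d (e j) \<in> D" "H (e j) \<subseteq> L" if "j \<in> {1..s}" for j
    using d H eT[OF that] by blast+
  ultimately show ?thesis
    using \<open>1 \<le> s\<close>
    by (intro exI[of _ s] exI[of _ "\<lambda>j. d (e j)"] exI[of _ "\<lambda>j. H (e j)"] conjI ballI)
qed

end
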